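(* The set $\mathsf{CND}$ is primitive recursive.
   Context: Modal formulas are built from propositional variables $p_0,p_1,\ldots$ and $\bot$ by $\neg,\land,\lor,\to,\Box$, and are coded by natural numbers in a standard way. A modal logic is a set of modal formulas containing all classical tautologies and closed under Modus Ponens and uniform substitution. $\mathsf{CND}$ is the smallest modal logic closed under the necessitation rule (from $A$ infer $\Box A$) and containing all instances of the schemes $\mathsf{C}$: $\Box A\land\Box B\to\Box(A\land B)$ and $\mathsf{D}$: $\neg(\Box A\land\Box\neg A)$. (A logic is identified with its set of theorems.) *)

theory Defs
  imports Main "HOL-Library.Nat_Bijection"
begin

datatype fm =
    Var nat
  | Bot
  | Neg fm
  | Conj fm fm
  | Disj fm fm
  | Imp fm fm
  | Box fm

primrec fm_code :: "fm \<Rightarrow> nat" where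
  "fm_code (Var n) = prod_encode (0, n)"
| "fm_code Bot = prod_encode (1, 0)"
| "fm_code (Neg A) = prod_encode (2, fm_code A)"
| "fm_code (Conj A B) = prod_encode (3, prod_encode (fm_code A, fm_code B))"
| "fm_code (Disj A B) = prod_encode (4, prod_encode (fm_code A, fm_code B))"
| "fm_code (Imp A B) = prod_encode (5, prod_encode (fm_code A, fm_code B))"
| "fm_code (Box A) = prod_encode (6, fm_code A)"

lemma inj_fm_code: "inj fm_code"
proof (rule injI)
  fix A B
  show "fm_code A = fm_code B \<Longrightarrow> A = B"
    by (induction A arbitrary: B; case_tac B) auto
qed

primrec fm_subst :: "(nat \<Rightarrow> fm) \<Rightarrow> fm \<Rightarrow> fm" where
  "fm_subst \<sigma> (Var n) = \<sigma> n"
| "fm_subst \<sigma> Bot = Bot"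
| "fm_subst \<sigma> (Neg A) = Neg (fm_subst \<sigma> A)"
| "fm_subst \<sigma> (Conj A B) = Conj (fm_subst \<sigma> A) (fm_subst \<sigma> B)"
| "fm_subst \<sigma> (Disj A B) = Disj (fm_subst \<sigma> A) (fm_subst \<sigma> B)"
| "fm_subst \<sigma> (Imp A B) = Imp (fm_subst \<sigma> A) (fm_subst \<sigma> B)"
| "fm_subst \<sigma> (Box A) = Box (fm_subst \<sigma> A)"

text \<open>Classical truth value: boxed formulas are treated as atoms, so a valuation
  assigns arbitrary truth values to variables and to boxed formulas.\<close>

primrec truth :: "(nat \<Rightarrow> bool) \<Rightarrow> (fm \<Rightarrow> bool) \<Rightarrow> fm \<Rightarrow> bool" where
  "truth v b (Var n) = v n"
| "truth v b Bot = False"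
| "truth v b (Neg A) = (\<not> truth v b A)"
| "truth v b (Conj A B) = (truth v b A \<and> truth v b B)"
| "truth v b (Disj A B) = (truth v b A \<or> truth v b B)"
| "truth v b (Imp A B) = (truth v b A \<longrightarrow> truth v b B)"
| "truth v b (Box A) = b A"

definition tautology :: "fm \<Rightarrow> bool" where
  "tautology A \<longleftrightarrow> (\<forall>v b. truth v b A)"

definition modal_logic :: "fm set \<Rightarrow> bool" where
  "modal_logic L \<longleftrightarrow>
     (\<forall>A. tautology A \<longrightarrow> A \<in> L) \<and>
     (\<forall>A B. A \<in> L \<and> Imp A B \<in> L \<longrightarrow> B \<in> L) \<and>
     (\<forall>A \<sigma>. A \<in> L \<longrightarrow> fm_subst \<sigma> A \<in> L)"

definition CND_closed :: "fm set \<Rightarrow> bool" where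
  "CND_closed L \<longleftrightarrow>
     modal_logic L \<and>
     (\<forall>A. A \<in> L \<longrightarrow> Box A \<in> L) \<and>
     (\<forall>A B. Imp (Conj (Box A) (Box B)) (Box (Conj A B)) \<in> L) \<and>
     (\<forall>A. Neg (Conj (Box A) (Box (Neg A))) \<in> L)"

definition CND :: "fm set" where
  "CND = \<Inter> {L. CND_closed L}"

lemma CND_closed_CND: "CND_closed CND"
  unfolding CND_def CND_closed_def modal_logic_def by blast

lemma CND_least: "CND_closed L \<Longrightarrow> CND \<subseteq> L"
  unfolding CND_def by blast

text \<open>\<open>prim_rec n f\<close>: on argument lists of length \<open>n\<close>, the function \<open>f\<close> is an \<open>n\<close>-ary
  primitive recursive function. The values of \<open>f\<close> on lists of other lengths carry no meaning.
  In the recursion rule the recursion argument is the head of the list.\<close>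

inductive prim_rec :: "nat \<Rightarrow> (nat list \<Rightarrow> nat) \<Rightarrow> bool" where
  zero: "prim_rec n (\<lambda>xs. 0)"
| succ: "prim_rec 1 (\<lambda>xs. Suc (xs ! 0))"
| proj: "i < n \<Longrightarrow> prim_rec n (\<lambda>xs. xs ! i)"
| comp: "prim_rec (length gs) f \<Longrightarrow> (\<forall>g \<in> set gs. prim_rec n g) \<Longrightarrow>
         prim_rec n (\<lambda>xs. f (map (\<lambda>g. g xs) gs))"
| prec: "prim_rec n f \<Longrightarrow> prim_rec (n + 2) g \<Longrightarrow>
         prim_rec (n + 1)
           (\<lambda>xs. rec_nat (f (tl xs)) (\<lambda>y r. g (y # r # tl xs)) (hd xs))"

definition prim_rec_set :: "nat set \<Rightarrow> bool" where
  "prim_rec_set S \<longleftrightarrow> (\<exists>f. prim_rec 1 f \<and> (\<forall>n. f [n] = (if n \<in> S then 1 else 0)))"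

end

theory Submission
  imports Defs
begin

text \<open>The modality of \<open>CND\<close> need not respect provable equivalence, so \<open>Box A\<close> is essentially an atom that
  depends on the syntactic formula \<open>A\<close>. The logic nevertheless has a finite countermodel property.

  Let \<open>S\<close> be a set of formulas closed under subformulas. A type is a subset \<open>t\<close> of \<open>S\<close>, read as the
  set of formulas true at a world. A set \<open>U\<close> of types is acceptable if each \<open>t\<close> in \<open>U\<close> respects the
  propositional connectives and comes with a set \<open>X\<close> of formulas from \<open>S\<close>, the boxed ones, such that
  \<open>X\<close> contains the members of \<open>S\<close> that belong to all types of \<open>U\<close>, is closed under those conjunctions
  that lie in \<open>S\<close>, agrees with \<open>t\<close> on the formulas \<open>Box A\<close> in \<open>S\<close>, and is included in some type of \<open>U\<close>.
  A formula \<open>A\<close> in \<open>S\<close> is a non-theorem of \<open>CND\<close> iff some acceptable \<open>U\<close> has a type that omits \<open>A\<close>.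

  If there is such a \<open>U\<close> then truth extends to all formulas: \<open>Box C\<close> is true at \<open>t\<close> iff \<open>C\<close> is
  obtained by conjunctions from members of \<open>X\<close> and formulas true everywhere. This agrees with
  membership in \<open>t\<close> on \<open>S\<close>, and all theorems are true everywhere: scheme \<open>D\<close> holds because all formulas
  boxed at \<open>t\<close> are true together at the type that includes \<open>X\<close> (\<open>countermodel_sound\<close>).
  Conversely, if \<open>A\<close> is not a theorem, one takes for \<open>U\<close> the intersections with \<open>S\<close> of all complete
  theories that extend \<open>CND\<close>. The formulas boxed in a complete theory are consistent with \<open>CND\<close>, by
  \<open>C\<close> and \<open>D\<close> (\<open>countermodel_complete\<close>).

  For \<open>S\<close> take the formulas with code at most \<open>n\<close>, which are closed under subformulas. Coding finite
  sets by binary expansions, types are numbers below \<open>2 ^ (n + 1)\<close> and sets of types are numbers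
  below \<open>2 ^ 2 ^ (n + 1)\<close>, so that provability is expressed with bounded quantifiers only
  (\<open>code_in_CND_iff\<close>), and bounded quantification preserves primitive recursiveness. Recursion on
  formulas is avoided in the same way, by guessing the set of all formula codes up to \<open>n\<close>.\<close>

section \<open>Primitive recursive functions and predicates\<close>

text \<open>Primitive recursiveness up to equality on argument lists of the right length. The values on other
  lists are ignored, which makes the notion extensional.\<close>

definition pr_fun :: "nat \<Rightarrow> (nat list \<Rightarrow> nat) \<Rightarrow> bool" where
  "pr_fun n f \<longleftrightarrow> (\<exists>g. prim_rec n g \<and> (\<forall>xs. length xs = n \<longrightarrow> f xs = g xs))"

definition pr_pred :: "nat \<Rightarrow> (nat list \<Rightarrow> bool) \<Rightarrow> bool" where
  "pr_pred n P \<longleftrightarrow> pr_fun n (\<lambda>xs. of_bool (P xs))"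

text \<open>\<open>h\<close> drops all but the last \<open>m\<close> entries of an argument list of length \<open>n\<close>. The rules below treat
  argument lists as environments: a recursion or a bounded quantifier puts its variable at the
  head, so every variable has the form \<open>hd (tl (... (tl xs)))\<close>.\<close>

definition env_suffix :: "nat \<Rightarrow> nat \<Rightarrow> (nat list \<Rightarrow> nat list) \<Rightarrow> bool" where
  "env_suffix n m h \<longleftrightarrow> m \<le> n \<and> (\<forall>xs. length xs = n \<longrightarrow> h xs = drop (n - m) xs)"

lemma pr_fun_cong:
  assumes "pr_fun n f" and "\<And>xs. length xs = n \<Longrightarrow> f xs = g xs"
  shows "pr_fun n g"
  using assms unfolding pr_fun_def by metis

lemma pr_fun_compose:
  assumes f: "pr_fun (length gs) f" and gs: "\<forall>g\<in>set gs. pr_fun n g"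
  shows "pr_fun n (\<lambda>xs. f (map (\<lambda>g. g xs) gs))"
proof -
  obtain f' where f': "prim_rec (length gs) f'"
    and f_eq: "\<And>xs. length xs = length gs \<Longrightarrow> f xs = f' xs"
    using f unfolding pr_fun_def by blast
  obtain h where h: "\<And>g. g \<in> set gs \<Longrightarrow> prim_rec n (h g)"
    and h_eq: "\<And>g xs. g \<in> set gs \<Longrightarrow> length xs = n \<Longrightarrow> g xs = h g xs"
    using gs unfolding pr_fun_def by metis
  have "prim_rec n (\<lambda>xs. f' (map (\<lambda>g. g xs) (map h gs)))"
    using f' h by (intro prim_rec.comp) auto
  moreover have "f (map (\<lambda>g. g xs) gs) = f' (map (\<lambda>g. g xs) (map h gs))"
    if "length xs = n" for xs
  proof -
    have "map (\<lambda>g. g xs) gs = map (\<lambda>g. g xs) (map h gs)"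
      using h_eq that by simp
    then show ?thesis using f_eq[of "map (\<lambda>g. g xs) gs"] by (simp only: length_map)
  qed
  ultimately show ?thesis unfolding pr_fun_def by blast
qed

lemma pr_fun_compose1:
  assumes "pr_fun (Suc 0) (\<lambda>xs. f (hd xs))" and "pr_fun n g"
  shows "pr_fun n (\<lambda>xs. f (g xs))"
  using pr_fun_compose[of "[g]" "\<lambda>xs. f (hd xs)" n] assms by simp

lemma pr_pred_compose2:
  assumes "pr_pred (Suc (Suc 0)) (\<lambda>xs. P (hd xs) (hd (tl xs)))" and "pr_fun n f" and "pr_fun n g"
  shows "pr_pred n (\<lambda>xs. P (f xs) (g xs))"
  using pr_fun_compose[of "[f, g]" "\<lambda>xs. of_bool (P (hd xs) (hd (tl xs)))" n] assms
  unfolding pr_pred_def by simp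

lemma env_suffix_refl: "env_suffix n n (\<lambda>xs. xs)"
  unfolding env_suffix_def by simp

lemma env_suffix_tl: "env_suffix n (Suc m) h \<Longrightarrow> env_suffix n m (\<lambda>xs. tl (h xs))"
  unfolding env_suffix_def by (auto simp: tl_drop drop_Suc[symmetric] Suc_diff_Suc Suc_le_eq)

lemma pr_fun_nth: "i < n \<Longrightarrow> pr_fun n (\<lambda>xs. xs ! i)"
  unfolding pr_fun_def using prim_rec.proj by blast

lemma pr_fun_hd:
  assumes "env_suffix n (Suc m) h"
  shows "pr_fun n (\<lambda>xs. hd (h xs))"
proof (rule pr_fun_cong)
  show "pr_fun n (\<lambda>xs. xs ! (n - Suc m))"
    using assms unfolding env_suffix_def by (intro pr_fun_nth) simp
  show "xs ! (n - Suc m) = hd (h xs)" if "length xs = n" for xs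
    using assms that unfolding env_suffix_def by (simp add: hd_drop_conv_nth)
qed

lemma pr_fun_zero: "pr_fun n (\<lambda>xs. 0)"
  unfolding pr_fun_def using prim_rec.zero by blast

lemma pr_fun_Suc:
  assumes "pr_fun n f"
  shows "pr_fun n (\<lambda>xs. Suc (f xs))"
proof -
  have "pr_fun (Suc 0) (\<lambda>xs. Suc (xs ! 0))"
    unfolding pr_fun_def using prim_rec.succ by auto
  then show ?thesis
    using pr_fun_compose[of "[f]" "\<lambda>xs. Suc (xs ! 0)" n] assms by simp
qed

lemma pr_fun_const: "pr_fun n (\<lambda>xs. k)"
  by (induction k) (auto intro: pr_fun_zero pr_fun_Suc)

lemma pr_fun_rec:
  assumes b: "pr_fun n b" and f: "pr_fun n f"
    and g: "pr_fun (Suc (Suc n)) (\<lambda>ys. g (hd ys) (hd (tl ys)) (tl (tl ys)))"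
  shows "pr_fun n (\<lambda>xs. rec_nat (f xs) (\<lambda>y r. g y r xs) (b xs))"
proof -
  obtain f' where f': "prim_rec n f'" and f_eq: "\<And>xs. length xs = n \<Longrightarrow> f xs = f' xs"
    using f unfolding pr_fun_def by blast
  obtain g' where g': "prim_rec (n + 2) g'"
    and g_eq: "\<And>ys. length ys = Suc (Suc n) \<Longrightarrow> g (hd ys) (hd (tl ys)) (tl (tl ys)) = g' ys"
    using g unfolding pr_fun_def by auto
  have g_eq': "g y r xs = g' (y # r # xs)" if "length xs = n" for y r xs
    using g_eq[of "y # r # xs"] that by simp
  \<comment> \<open>The scheme recurses on the head, so the bound \<open>b xs\<close> is pushed onto the list.\<close>
  let ?r = "\<lambda>xs. rec_nat (f' (tl xs)) (\<lambda>y r. g' (y # r # tl xs)) (hd xs)"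
  let ?gs = "b # map (\<lambda>i xs. xs ! i) [0..<n]"
  have "pr_fun (length ?gs) ?r"
    unfolding pr_fun_def using prim_rec.prec[OF f' g'] by auto
  moreover have "\<forall>g\<in>set ?gs. pr_fun n g"
    using b by (auto intro: pr_fun_nth)
  ultimately have "pr_fun n (\<lambda>xs. ?r (map (\<lambda>g. g xs) ?gs))"
    by (rule pr_fun_compose)
  then show ?thesis
  proof (rule pr_fun_cong)
    fix xs :: "nat list" assume n: "length xs = n"
    have "map (\<lambda>g. g xs) ?gs = b xs # xs"
      using n map_nth[of xs] by (simp add: o_def)
    then show "?r (map (\<lambda>g. g xs) ?gs) = rec_nat (f xs) (\<lambda>y r. g y r xs) (b xs)"
      using n f_eq g_eq' by simp
  qed
qed

lemmas pr_basic = pr_fun_const pr_fun_hd env_suffix_refl env_suffix_tl pr_fun_Suc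

lemma pr_fun_env_suffix:
  assumes f: "pr_fun m f" and h: "env_suffix n m h"
  shows "pr_fun n (\<lambda>xs. f (h xs))"
proof -
  let ?gs = "map (\<lambda>i xs. xs ! (n - m + i)) [0..<m]"
  have m: "m \<le> n" using h unfolding env_suffix_def by simp
  have "pr_fun n (\<lambda>xs. f (map (\<lambda>g. g xs) ?gs))"
    using f m by (intro pr_fun_compose) (auto intro!: pr_fun_nth)
  then show ?thesis
  proof (rule pr_fun_cong)
    fix xs :: "nat list" assume n: "length xs = n"
    have "map (\<lambda>g. g xs) ?gs = drop (n - m) xs"
      using n m by (intro nth_equalityI) auto
    then show "f (map (\<lambda>g. g xs) ?gs) = f (h xs)"
      using h n unfolding env_suffix_def by simp
  qed
qed

lemma pr_fun_add:
  assumes f: "pr_fun n f" and g: "pr_fun n g"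
  shows "pr_fun n (\<lambda>xs. f xs + g xs)"
proof -
  have "pr_fun n (\<lambda>xs. rec_nat (f xs) (\<lambda>y r. Suc r) (g xs))"
    by (rule pr_fun_rec[OF g f]) (rule pr_basic)+
  moreover have "rec_nat a (\<lambda>y r. Suc r) b = a + b" for a b
    by (induction b) auto
  ultimately show ?thesis by simp
qed

lemma pr_fun_mult:
  assumes f: "pr_fun n f" and g: "pr_fun n g"
  shows "pr_fun n (\<lambda>xs. f xs * g xs)"
proof -
  have "pr_fun n (\<lambda>xs. rec_nat 0 (\<lambda>y r. r + f xs) (g xs))"
    by (rule pr_fun_rec[OF g]) (rule pr_basic pr_fun_add pr_fun_env_suffix[OF f])+
  moreover have "rec_nat 0 (\<lambda>y r. r + a) b = a * b" for a b :: nat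
    by (induction b) auto
  ultimately show ?thesis by simp
qed

lemma pr_fun_power2:
  assumes "pr_fun n f"
  shows "pr_fun n (\<lambda>xs. 2 ^ f xs)"
proof -
  have "pr_fun n (\<lambda>xs. rec_nat 1 (\<lambda>y r. 2 * r) (f xs))"
    by (rule pr_fun_rec[OF assms]) (rule pr_basic pr_fun_mult)+
  moreover have "rec_nat 1 (\<lambda>y r. 2 * r) b = (2::nat) ^ b" for b
    by (induction b) auto
  ultimately show ?thesis by simp
qed

lemma pr_fun_triangle:
  assumes "pr_fun n f"
  shows "pr_fun n (\<lambda>xs. triangle (f xs))"
proof -
  have "pr_fun n (\<lambda>xs. rec_nat 0 (\<lambda>y r. r + Suc y) (f xs))"
    by (rule pr_fun_rec[OF assms]) (rule pr_basic pr_fun_add)+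
  moreover have "rec_nat 0 (\<lambda>y r. r + Suc y) b = triangle b" for b
    by (induction b) auto
  ultimately show ?thesis by simp
qed

lemma pr_fun_prod_encode:
  assumes "pr_fun n f" and "pr_fun n g"
  shows "pr_fun n (\<lambda>xs. prod_encode (f xs, g xs))"
  unfolding prod_encode_def using assms by (simp add: pr_fun_add pr_fun_triangle)

lemma pr_fun_diff:
  assumes f: "pr_fun n f" and g: "pr_fun n g"
  shows "pr_fun n (\<lambda>xs. f xs - g xs)"
proof -
  have "pr_fun (Suc 0) (\<lambda>xs. rec_nat 0 (\<lambda>y r. y) (hd xs))"
    by (rule pr_fun_rec) (rule pr_basic)+
  moreover have "rec_nat 0 (\<lambda>y r. y) b = b - 1" for b :: nat
    by (cases b) auto
  ultimately have pred: "pr_fun (Suc 0) (\<lambda>xs. hd xs - 1)" by simp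
  have "pr_fun n (\<lambda>xs. rec_nat (f xs) (\<lambda>y r. r - 1) (g xs))"
    by (rule pr_fun_rec[OF g f]) (rule pr_fun_compose1[OF pred] pr_basic)+
  moreover have "rec_nat a (\<lambda>y r. r - 1) b = a - b" for a b :: nat
    by (induction b) auto
  ultimately show ?thesis by simp
qed

lemma pr_pred_not:
  assumes "pr_pred n P"
  shows "pr_pred n (\<lambda>xs. \<not> P xs)"
proof -
  have "pr_fun n (\<lambda>xs. 1 - of_bool (P xs))"
    using assms unfolding pr_pred_def by (intro pr_fun_diff pr_fun_const)
  moreover have "1 - of_bool b = (of_bool (\<not> b) :: nat)" for b
    by simp
  ultimately show ?thesis unfolding pr_pred_def by simp
qed

lemma pr_pred_conj:
  assumes "pr_pred n P" and "pr_pred n Q"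
  shows "pr_pred n (\<lambda>xs. P xs \<and> Q xs)"
  using assms pr_fun_mult unfolding pr_pred_def of_bool_conj by blast

lemma pr_pred_disj:
  assumes "pr_pred n P" and "pr_pred n Q"
  shows "pr_pred n (\<lambda>xs. P xs \<or> Q xs)"
proof -
  have "pr_pred n (\<lambda>xs. \<not> (\<not> P xs \<and> \<not> Q xs))"
    by (intro pr_pred_not pr_pred_conj assms)
  then show ?thesis by simp
qed

lemma pr_pred_imp:
  assumes "pr_pred n P" and "pr_pred n Q"
  shows "pr_pred n (\<lambda>xs. P xs \<longrightarrow> Q xs)"
proof -
  have "pr_pred n (\<lambda>xs. \<not> P xs \<or> Q xs)"
    by (intro pr_pred_disj pr_pred_not assms)
  then show ?thesis by (simp only: imp_conv_disj)
qed

lemma pr_pred_iff: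
  assumes "pr_pred n P" and "pr_pred n Q"
  shows "pr_pred n (\<lambda>xs. P xs \<longleftrightarrow> Q xs)"
proof -
  have "pr_pred n (\<lambda>xs. (P xs \<longrightarrow> Q xs) \<and> (Q xs \<longrightarrow> P xs))"
    by (intro pr_pred_conj pr_pred_imp assms)
  then show ?thesis by (simp only: iff_conv_conj_imp)
qed

lemma pr_pred_eq:
  assumes "pr_fun n f" and "pr_fun n g"
  shows "pr_pred n (\<lambda>xs. f xs = g xs)"
proof -
  have "pr_fun n (\<lambda>xs. 1 - ((f xs - g xs) + (g xs - f xs)))"
    by (intro pr_fun_diff pr_fun_add pr_fun_const assms)
  \<comment> \<open>Truncated subtraction: the sum is 0 exactly when \<open>a\<close> and \<open>b\<close> are equal.\<close>
  moreover have "1 - ((a - b) + (b - a)) = (of_bool (a = b) :: nat)" for a b :: nat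
    by auto
  ultimately show ?thesis unfolding pr_pred_def by simp
qed

text \<open>Bounded universal quantification is a bounded product of truth values. In the second premise,
  the bound variable has become the head of the environment.\<close>

lemma pr_pred_ball:
  assumes b: "pr_fun n b" and P: "pr_pred (Suc n) (\<lambda>ys. P (hd ys) (tl ys))"
  shows "pr_pred n (\<lambda>xs. \<forall>y<b xs. P y xs)"
proof -
  let ?Q = "\<lambda>ys. of_bool (P (hd ys) (tl ys)) :: nat"
  let ?gs = "hd # map (\<lambda>i xs. xs ! Suc (Suc i)) [0..<n]"
  have hd: "pr_fun (Suc (Suc n)) hd"
    using pr_fun_hd[OF env_suffix_refl] by simp
  have r: "pr_fun (Suc (Suc n)) (\<lambda>zs. hd (tl zs))"
    by (rule pr_fun_hd[OF env_suffix_tl[OF env_suffix_refl]])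
  have "pr_fun (length ?gs) ?Q"
    using P unfolding pr_pred_def by simp
  moreover have "\<forall>g\<in>set ?gs. pr_fun (Suc (Suc n)) g"
    using hd by (auto intro!: pr_fun_nth)
  ultimately have "pr_fun (Suc (Suc n)) (\<lambda>zs. ?Q (map (\<lambda>g. g zs) ?gs))"
    by (rule pr_fun_compose)
  then have P': "pr_fun (Suc (Suc n)) (\<lambda>zs. of_bool (P (hd zs) (tl (tl zs))))"
  proof (rule pr_fun_cong)
    fix zs :: "nat list" assume len: "length zs = Suc (Suc n)"
    have "map (\<lambda>i. zs ! Suc (Suc i)) [0..<n] = tl (tl zs)"
      using len by (intro nth_equalityI) (auto simp: nth_tl)
    then show "?Q (map (\<lambda>g. g zs) ?gs) = of_bool (P (hd zs) (tl (tl zs)))"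
      by (simp add: o_def)
  qed
  have "pr_fun n (\<lambda>xs. rec_nat 1 (\<lambda>y r. r * of_bool (P y xs)) (b xs))"
    by (rule pr_fun_rec[OF b pr_fun_const]) (rule pr_fun_mult[OF r P'])
  moreover have "rec_nat 1 (\<lambda>y r. r * of_bool (P y xs)) k = (of_bool (\<forall>y<k. P y xs) :: nat)"
    for k xs
    by (induction k) (auto simp: less_Suc_eq)
  ultimately show ?thesis unfolding pr_pred_def by simp
qed

lemma pr_pred_bex:
  assumes b: "pr_fun n b" and P: "pr_pred (Suc n) (\<lambda>ys. P (hd ys) (tl ys))"
  shows "pr_pred n (\<lambda>xs. \<exists>y<b xs. P y xs)"
proof -
  have "pr_pred n (\<lambda>xs. \<not> (\<forall>y<b xs. \<not> P y xs))"
    by (intro pr_pred_not pr_pred_ball b P)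
  then show ?thesis by simp
qed

text \<open>Membership \<open>c \<in> set_decode t\<close> means that bit \<open>c\<close> of \<open>t\<close> is 1, that is, \<open>t div 2 ^ c\<close> is odd.
  Written with bounded quantifiers it needs no division.\<close>

lemma mem_set_decode_iff:
  "c \<in> set_decode t \<longleftrightarrow> (\<exists>q<Suc t. \<exists>r<2 ^ c. t = Suc (2 * q) * 2 ^ c + r)"
proof
  assume "c \<in> set_decode t"
  then have "odd (t div 2 ^ c)" by (simp add: set_decode_def)
  then obtain q where q: "t div 2 ^ c = Suc (2 * q)" by (auto elim: oddE)
  have "t = Suc (2 * q) * 2 ^ c + t mod 2 ^ c"
    using div_mult_mod_eq[of t "2 ^ c"] q by simp
  moreover have "q < Suc t"
    using q div_le_dividend[of t "2 ^ c"] by linarith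
  ultimately show "\<exists>q<Suc t. \<exists>r<2 ^ c. t = Suc (2 * q) * 2 ^ c + r"
    using mod_less_divisor[of "2 ^ c" t] by (meson zero_less_numeral zero_less_power)
next
  assume "\<exists>q<Suc t. \<exists>r<2 ^ c. t = Suc (2 * q) * 2 ^ c + r"
  then obtain q r where r: "r < 2 ^ c" and t: "t = Suc (2 * q) * 2 ^ c + r" by blast
  have "t div 2 ^ c = Suc (2 * q)"
    unfolding t using r by (simp add: div_mult_self3 del: mult_Suc)
  then show "c \<in> set_decode t" by (simp add: set_decode_def)
qed

lemma pr_pred_mem:
  assumes "pr_fun n f" and "pr_fun n g"
  shows "pr_pred n (\<lambda>xs. f xs \<in> set_decode (g xs))"
proof (rule pr_pred_compose2[OF _ assms])
  show "pr_pred (Suc (Suc 0)) (\<lambda>xs. hd xs \<in> set_decode (hd (tl xs)))"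
    unfolding mem_set_decode_iff
    by (rule pr_pred_bex pr_pred_eq pr_fun_power2 pr_fun_add pr_fun_mult pr_basic)+
qed

lemmas pr_intros = pr_pred_not pr_pred_conj pr_pred_disj pr_pred_imp pr_pred_iff
  pr_pred_ball pr_pred_bex pr_pred_eq pr_pred_mem
  pr_fun_prod_encode pr_fun_power2 pr_basic

section \<open>Finite countermodels\<close>

text \<open>\<open>X\<close> is an admissible set of boxed formulas at the type \<open>t\<close>, relative to the set \<open>U\<close> of types. The
  last clause, seriality, corresponds to scheme \<open>D\<close>. It quantifies over \<open>S\<close>, since \<open>X\<close> will always be a
  subset of \<open>S\<close>.\<close>

definition box_set :: "fm set \<Rightarrow> fm set set \<Rightarrow> fm set \<Rightarrow> fm set \<Rightarrow> bool" where
  "box_set S U t X \<longleftrightarrow>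
     (\<forall>A\<in>S. (\<forall>u\<in>U. A \<in> u) \<longrightarrow> A \<in> X) \<and>
     (\<forall>A\<in>S. \<forall>B\<in>S. Conj A B \<in> S \<longrightarrow> A \<in> X \<longrightarrow> B \<in> X \<longrightarrow> Conj A B \<in> X) \<and>
     (\<forall>A\<in>S. Box A \<in> S \<longrightarrow> (Box A \<in> t \<longleftrightarrow> A \<in> X)) \<and>
     (\<exists>u\<in>U. \<forall>A\<in>S. A \<in> X \<longrightarrow> A \<in> u)"

text \<open>\<open>t\<close> respects the connectives within \<open>S\<close> and has an admissible set of boxed formulas.\<close>

definition coherent :: "fm set \<Rightarrow> fm set set \<Rightarrow> fm set \<Rightarrow> bool" where
  "coherent S U t \<longleftrightarrow>
     Bot \<notin> t \<and>
     (\<forall>A\<in>S. Neg A \<in> S \<longrightarrow> (Neg A \<in> t \<longleftrightarrow> A \<notin> t)) \<and>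
     (\<forall>A\<in>S. \<forall>B\<in>S.
        (Conj A B \<in> S \<longrightarrow> (Conj A B \<in> t \<longleftrightarrow> A \<in> t \<and> B \<in> t)) \<and>
        (Disj A B \<in> S \<longrightarrow> (Disj A B \<in> t \<longleftrightarrow> A \<in> t \<or> B \<in> t)) \<and>
        (Imp A B \<in> S \<longrightarrow> (Imp A B \<in> t \<longleftrightarrow> (A \<in> t \<longrightarrow> B \<in> t)))) \<and>
     (\<exists>X\<in>Pow S. box_set S U t X)"

text \<open>A set of coherent types, at least one of which omits \<open>A\<close>.\<close>

definition countermodel :: "fm set \<Rightarrow> fm \<Rightarrow> fm set set \<Rightarrow> bool" where
  "countermodel S A U \<longleftrightarrow> (\<forall>t\<in>U. coherent S U t) \<and> (\<exists>t\<in>U. A \<notin> t)"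

definition subfm_closed :: "fm set \<Rightarrow> bool" where
  "subfm_closed S \<longleftrightarrow>
     (\<forall>A. Neg A \<in> S \<longrightarrow> A \<in> S) \<and> (\<forall>A. Box A \<in> S \<longrightarrow> A \<in> S) \<and>
     (\<forall>A B. Conj A B \<in> S \<or> Disj A B \<in> S \<or> Imp A B \<in> S \<longrightarrow> A \<in> S \<and> B \<in> S)"

section \<open>Soundness of countermodels\<close>

text \<open>Truth of an arbitrary formula at a type, where \<open>X t\<close> is the set of boxed formulas chosen for \<open>t\<close>.
  \<open>boxed U X A t\<close> says that \<open>A\<close> belongs to the closure of \<open>X t\<close> and the formulas true at
  all types under conjunction. The closure is decomposed along the syntax of \<open>A\<close>, which makes the
  recursion well-founded.\<close>

function holds boxed :: "fm set set \<Rightarrow> (fm set \<Rightarrow> fm set) \<Rightarrow> fm \<Rightarrow> fm set \<Rightarrow> bool" where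
  "holds U X (Var n) t = (Var n \<in> t)"
| "holds U X Bot t = False"
| "holds U X (Neg A) t = (\<not> holds U X A t)"
| "holds U X (Conj A B) t = (holds U X A t \<and> holds U X B t)"
| "holds U X (Disj A B) t = (holds U X A t \<or> holds U X B t)"
| "holds U X (Imp A B) t = (holds U X A t \<longrightarrow> holds U X B t)"
| "holds U X (Box A) t = boxed U X A t"
| "boxed U X A t = (A \<in> X t \<or> (\<forall>u\<in>U. holds U X A u) \<or>
     (case A of Conj B C \<Rightarrow> boxed U X B t \<and> boxed U X C t | _ \<Rightarrow> False))"
  by pat_completeness auto
termination
  by (relation "measure (\<lambda>x. case x of Inl (U, X, A, t) \<Rightarrow> 2 * size A | Inr (U, X, A, t) \<Rightarrow> Suc (2 * size A))")
    auto

text \<open>The equation for \<open>boxed\<close> applies to every formula, so it is unfolded only where it is needed.\<close>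

declare boxed.simps [simp del]

lemma holds_eq_truth: "holds U X A t = truth (\<lambda>n. Var n \<in> t) (\<lambda>B. boxed U X B t) A"
  by (induction A) auto

lemma truth_subst:
  "truth v b (fm_subst \<sigma> A) = truth (\<lambda>n. truth v b (\<sigma> n)) (\<lambda>B. b (fm_subst \<sigma> B)) A"
  by (induction A) auto

lemma fm_subst_subst: "fm_subst \<sigma> (fm_subst \<tau> A) = fm_subst (\<lambda>n. fm_subst \<sigma> (\<tau> n)) A"
  by (induction A) auto

lemma fm_subst_Var: "fm_subst Var A = A"
  by (induction A) auto

text \<open>The set \<open>V\<close> need not be closed under substitution: the formulas all of whose
  substitution instances lie in \<open>V\<close> form a set that is, since instances of the axiom schemes are again
  instances of them.\<close>

lemma CND_subsetI:
  assumes taut: "\<And>A. tautology A \<Longrightarrow> A \<in> V"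
    and mp: "\<And>A B. A \<in> V \<Longrightarrow> Imp A B \<in> V \<Longrightarrow> B \<in> V"
    and nec: "\<And>A. A \<in> V \<Longrightarrow> Box A \<in> V"
    and C: "\<And>A B. Imp (Conj (Box A) (Box B)) (Box (Conj A B)) \<in> V"
    and D: "\<And>A. Neg (Conj (Box A) (Box (Neg A))) \<in> V"
  shows "CND \<subseteq> V"
proof -
  let ?W = "{A. \<forall>\<sigma>. fm_subst \<sigma> A \<in> V}"
  have "CND_closed ?W"
    unfolding CND_closed_def modal_logic_def
  proof (intro conjI allI impI CollectI)
    show "fm_subst \<sigma> A \<in> V" if "tautology A" for A \<sigma>
      using that by (intro taut) (simp add: tautology_def truth_subst)
    show "fm_subst \<sigma> B \<in> V" if "A \<in> ?W \<and> Imp A B \<in> ?W" for A B \<sigma>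
      by (rule mp[of "fm_subst \<sigma> A"]) (use that in simp_all)
    show "fm_subst \<sigma> (fm_subst \<tau> A) \<in> V" if "A \<in> ?W" for A \<sigma> \<tau>
      using that by (simp add: fm_subst_subst)
    show "fm_subst \<sigma> (Box A) \<in> V" if "A \<in> ?W" for A \<sigma>
      using that by (simp add: nec)
  qed (simp_all add: C D)
  then have "CND \<subseteq> ?W" by (rule CND_least)
  also have "?W \<subseteq> V" using fm_subst_Var by (metis (mono_tags, lifting) mem_Collect_eq subsetI)
  finally show ?thesis .
qed

lemma countermodel_sound:
  assumes S: "subfm_closed S" and A: "A \<in> S" and cm: "countermodel S A U"
  shows "A \<notin> CND"
proof -
  have coh: "\<And>t. t \<in> U \<Longrightarrow> coherent S U t"
    using cm unfolding countermodel_def by blast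
  obtain t0 where t0: "t0 \<in> U" "A \<notin> t0"
    using cm unfolding countermodel_def by blast
  have "\<forall>t\<in>U. \<exists>X\<in>Pow S. box_set S U t X"
    using coh unfolding coherent_def by blast
  then obtain X where "\<forall>t\<in>U. X t \<in> Pow S \<and> box_set S U t (X t)" by metis
  then have X: "X t \<subseteq> S" and bs: "box_set S U t (X t)" if "t \<in> U" for t
    using that by blast+
  have prov: "A \<in> X t" if "t \<in> U" "A \<in> S" "\<forall>u\<in>U. A \<in> u" for t A
    using bs[OF that(1)] that(2,3) unfolding box_set_def by blast
  have conj: "Conj A B \<in> X t"
    if "t \<in> U" "A \<in> S" "B \<in> S" "Conj A B \<in> S" "A \<in> X t" "B \<in> X t" for t A B
    using bs[OF that(1)] that(2-) unfolding box_set_def by blast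
  have box: "Box A \<in> t \<longleftrightarrow> A \<in> X t" if "t \<in> U" "A \<in> S" "Box A \<in> S" for t A
    using bs[OF that(1)] that(2-) unfolding box_set_def by blast
  have ser: "\<exists>u\<in>U. \<forall>A\<in>S. A \<in> X t \<longrightarrow> A \<in> u" if "t \<in> U" for t
    using bs[OF that] unfolding box_set_def by blast
  let ?h = "holds U X" and ?b = "boxed U X"
  have truth_lemma: "(\<forall>t\<in>U. ?h C t \<longleftrightarrow> C \<in> t) \<and> (\<forall>t\<in>U. ?b C t \<longleftrightarrow> C \<in> X t)" if "C \<in> S" for C
  proof -
    have boxed_case: "\<forall>t\<in>U. ?b C t \<longleftrightarrow> C \<in> X t"
      if h: "\<forall>t\<in>U. ?h C t \<longleftrightarrow> C \<in> t" and C: "C \<in> S"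
        and c: "\<And>B B' t. C = Conj B B' \<Longrightarrow> t \<in> U \<Longrightarrow> ?b B t \<Longrightarrow> ?b B' t \<Longrightarrow> C \<in> X t" for C
    proof
      fix t assume t: "t \<in> U"
      have "(\<forall>u\<in>U. ?h C u) \<longrightarrow> C \<in> X t" using h prov[OF t C] by simp
      moreover have "(case C of Conj B B' \<Rightarrow> ?b B t \<and> ?b B' t | _ \<Rightarrow> False) \<longrightarrow> C \<in> X t"
        using c[OF _ t] by (cases C) simp_all
      ultimately show "?b C t \<longleftrightarrow> C \<in> X t" by (subst boxed.simps) blast
    qed
    show ?thesis
      using that
    proof (induction C)
      case (Var n)
      then show ?case using boxed_case[of "Var n"] by auto
    next
      case Bot
      then show ?case using boxed_case[of Bot] coh unfolding coherent_def by auto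
    next
      case (Neg B)
      then have B: "B \<in> S" using S unfolding subfm_closed_def by blast
      have "\<forall>t\<in>U. ?h (Neg B) t \<longleftrightarrow> Neg B \<in> t"
        using Neg B coh unfolding coherent_def by auto
      then show ?case using boxed_case[of "Neg B"] Neg.prems by auto
    next
      case (Conj B C)
      then have BC: "B \<in> S" "C \<in> S" using S unfolding subfm_closed_def by blast+
      have "\<forall>t\<in>U. ?h (Conj B C) t \<longleftrightarrow> Conj B C \<in> t"
        using Conj BC coh unfolding coherent_def by auto
      moreover have "\<forall>t\<in>U. ?b (Conj B C) t \<longleftrightarrow> Conj B C \<in> X t"
        using calculation Conj.prems
        by (rule boxed_case) (use Conj.IH BC conj[OF _ BC Conj.prems] in simp)
      ultimately show ?case by blast
    next
      case (Disj B C)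
      then have BC: "B \<in> S" "C \<in> S" using S unfolding subfm_closed_def by blast+
      have "\<forall>t\<in>U. ?h (Disj B C) t \<longleftrightarrow> Disj B C \<in> t"
        using Disj BC coh unfolding coherent_def by auto
      then show ?case using boxed_case[of "Disj B C"] Disj.prems by auto
    next
      case (Imp B C)
      then have BC: "B \<in> S" "C \<in> S" using S unfolding subfm_closed_def by blast+
      have "\<forall>t\<in>U. ?h (Imp B C) t \<longleftrightarrow> Imp B C \<in> t"
        using Imp BC coh unfolding coherent_def by auto
      then show ?case using boxed_case[of "Imp B C"] Imp.prems by auto
    next
      case (Box B)
      then have B: "B \<in> S" using S unfolding subfm_closed_def by blast
      have "\<forall>t\<in>U. ?h (Box B) t \<longleftrightarrow> Box B \<in> t"
        using Box B box by auto
      then show ?case using boxed_case[of "Box B"] Box.prems by auto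
    qed
  qed
  \<comment> \<open>A type that includes \<open>X t\<close> makes everything boxed at \<open>t\<close> true.\<close>
  have boxed_holds: "?h C u"
    if "?b C t" "t \<in> U" "u \<in> U" "\<forall>A\<in>S. A \<in> X t \<longrightarrow> A \<in> u" for C t u
  proof -
    have base: "?h B u" if "B \<in> X t \<or> (\<forall>u\<in>U. ?h B u)" for B
      using that X[OF \<open>t \<in> U\<close>] truth_lemma[of B] \<open>u \<in> U\<close> \<open>\<forall>A\<in>S. A \<in> X t \<longrightarrow> A \<in> u\<close> by blast
    show ?thesis
      using that(1)
    proof (induction C)
      case (Conj B C)
      then have "(Conj B C \<in> X t \<or> (\<forall>u\<in>U. ?h (Conj B C) u)) \<or> ?b B t \<and> ?b C t"
        using boxed.simps[of U X "Conj B C" t] by simp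
      then show ?case using base[of "Conj B C"] Conj.IH by (elim disjE) simp_all
    qed (rule base, simp add: boxed.simps[of U X _ t])+
  qed
  let ?V = "{C. \<forall>t\<in>U. ?h C t}"
  have "CND \<subseteq> ?V"
  proof (rule CND_subsetI)
    fix C assume "tautology C"
    then show "C \<in> ?V" by (simp add: holds_eq_truth tautology_def)
  next
    fix C assume "C \<in> ?V"
    then show "Box C \<in> ?V" by (simp add: boxed.simps)
  next
    fix B C
    show "Imp (Conj (Box B) (Box C)) (Box (Conj B C)) \<in> ?V"
      by (simp add: boxed.simps[of U X "Conj B C"])
  next
    fix C
    have "\<not> (?b C t \<and> ?b (Neg C) t)" if t: "t \<in> U" for t
    proof
      assume b: "?b C t \<and> ?b (Neg C) t"
      obtain u where "u \<in> U" "\<forall>A\<in>S. A \<in> X t \<longrightarrow> A \<in> u" using ser[OF t] by blast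
      then have "?h C u" "?h (Neg C) u" using b boxed_holds t by blast+
      then show False by simp
    qed
    then show "Neg (Conj (Box C) (Box (Neg C))) \<in> ?V" by simp
  qed auto
  then show ?thesis using t0 truth_lemma[OF A] by blast
qed

section \<open>Completeness: countermodels from complete theories\<close>

text \<open>A set of formulas that contains \<open>CND\<close> and is closed under Modus Ponens. Neither necessitation nor
  substitution is required.\<close>

definition CND_theory :: "fm set \<Rightarrow> bool" where
  "CND_theory L \<longleftrightarrow> CND \<subseteq> L \<and> (\<forall>A B. A \<in> L \<longrightarrow> Imp A B \<in> L \<longrightarrow> B \<in> L)"

lemma CND_taut: "tautology A \<Longrightarrow> A \<in> CND"
  using CND_closed_CND unfolding CND_closed_def modal_logic_def by blast

lemma CND_mp: "A \<in> CND \<Longrightarrow> Imp A B \<in> CND \<Longrightarrow> B \<in> CND"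
  using CND_closed_CND unfolding CND_closed_def modal_logic_def by blast

lemma CND_nec: "A \<in> CND \<Longrightarrow> Box A \<in> CND"
  using CND_closed_CND unfolding CND_closed_def by blast

lemma CND_C: "Imp (Conj (Box A) (Box B)) (Box (Conj A B)) \<in> CND"
  using CND_closed_CND unfolding CND_closed_def by blast

lemma CND_D: "Neg (Conj (Box A) (Box (Neg A))) \<in> CND"
  using CND_closed_CND unfolding CND_closed_def by blast

lemma CND_theory_CND: "CND_theory CND"
  unfolding CND_theory_def using CND_mp by blast

lemma theory_mp: "CND_theory L \<Longrightarrow> A \<in> L \<Longrightarrow> Imp A B \<in> L \<Longrightarrow> B \<in> L"
  unfolding CND_theory_def by blast

lemma theory_CND: "CND_theory L \<Longrightarrow> A \<in> CND \<Longrightarrow> A \<in> L"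
  unfolding CND_theory_def by blast

lemma theory_conseq1:
  assumes "CND_theory L" and "A \<in> L" and "tautology (Imp A B)"
  shows "B \<in> L"
  using assms theory_mp theory_CND CND_taut by blast

lemma theory_conseq2:
  assumes "CND_theory L" and "A \<in> L" and "B \<in> L" and "tautology (Imp A (Imp B C))"
  shows "C \<in> L"
  using assms theory_mp theory_CND CND_taut by blast

text \<open>A theory containing exactly one of \<open>A\<close> and \<open>Neg A\<close> for every formula \<open>A\<close>; in particular it is
  consistent.\<close>

definition complete_theory :: "fm set \<Rightarrow> bool" where
  "complete_theory M \<longleftrightarrow> CND_theory M \<and> (\<forall>A. Neg A \<in> M \<longleftrightarrow> A \<notin> M)"

text \<open>A theory that is maximal among those omitting \<open>A\<close> is complete: for \<open>B\<close> outside it, the theory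
  generated by adding \<open>B\<close> is \<open>{C. Imp B C \<in> M}\<close>, so it contains \<open>A\<close>.\<close>

lemma lindenbaum:
  assumes L: "CND_theory L" and A: "A \<notin> L"
  shows "\<exists>M. complete_theory M \<and> L \<subseteq> M \<and> A \<notin> M"
proof -
  let ?F = "{M. CND_theory M \<and> L \<subseteq> M \<and> A \<notin> M}"
  have "\<exists>M\<in>?F. \<forall>N\<in>?F. M \<subseteq> N \<longrightarrow> N = M"
  proof (rule subset_Zorn_nonempty)
    show "?F \<noteq> {}" using assms by blast
  next
    fix \<C> assume ne: "\<C> \<noteq> {}" and chain: "subset.chain ?F \<C>"
    have "CND_theory (\<Union>\<C>)"
      unfolding CND_theory_def
    proof (intro conjI allI impI)
      show "CND \<subseteq> \<Union>\<C>"
        using ne chain unfolding subset_chain_def CND_theory_def by fastforce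
    next
      fix B C assume "B \<in> \<Union>\<C>" "Imp B C \<in> \<Union>\<C>"
      then obtain M N where M: "M \<in> \<C>" "B \<in> M" and N: "N \<in> \<C>" "Imp B C \<in> N" by blast
      have "M \<subseteq> N \<or> N \<subseteq> M" using M N chain unfolding subset_chain_def by blast
      then obtain K where "K \<in> \<C>" "B \<in> K" "Imp B C \<in> K" using M N by blast
      then show "C \<in> \<Union>\<C>"
        using chain theory_mp unfolding subset_chain_def by blast
    qed
    then show "\<Union>\<C> \<in> ?F"
      using ne chain unfolding subset_chain_def by blast
  qed
  then obtain M where M: "CND_theory M" "L \<subseteq> M" "A \<notin> M"
    and max: "\<And>N. CND_theory N \<Longrightarrow> M \<subseteq> N \<Longrightarrow> A \<notin> N \<Longrightarrow> N = M"
    by (elim bexE) (simp, metis order_trans)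
  have imp: "Imp B A \<in> M" if "B \<notin> M" for B
  proof (rule ccontr)
    assume "Imp B A \<notin> M"
    \<comment> \<open>The theory generated by \<open>M\<close> and \<open>B\<close>.\<close>
    let ?N = "{C. Imp B C \<in> M}"
    have sub: "M \<subseteq> ?N"
      using theory_conseq1[OF M(1)] by (fastforce simp: tautology_def)
    have "CND_theory ?N"
      unfolding CND_theory_def
    proof (intro conjI allI impI)
      show "CND \<subseteq> ?N" using sub M(1) unfolding CND_theory_def by blast
    next
      fix C D assume "C \<in> ?N" "Imp C D \<in> ?N"
      then show "D \<in> ?N"
        using theory_conseq2[OF M(1), of "Imp B C" "Imp B (Imp C D)" "Imp B D"]
        by (auto simp: tautology_def)
    qed
    then have "?N = M" using max sub \<open>Imp B A \<notin> M\<close> by blast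
    moreover have "B \<in> ?N"
      using M(1) theory_CND CND_taut[of "Imp B B"] by (auto simp: tautology_def)
    ultimately show False using that by blast
  qed
  have "Neg B \<in> M \<longleftrightarrow> B \<notin> M" for B
  proof
    assume "Neg B \<in> M"
    then show "B \<notin> M"
      using theory_conseq2[OF M(1), of B "Neg B" A] M(3) by (auto simp: tautology_def)
  next
    assume "B \<notin> M"
    then show "Neg B \<in> M"
      using imp[of B] imp[of "Neg B"] theory_conseq2[OF M(1), of "Imp B A" "Imp (Neg B) A" A] M(3)
      by (auto simp: tautology_def)
  qed
  then show ?thesis using M unfolding complete_theory_def by blast
qed

lemma complete_theory_truth:
  assumes "complete_theory M"
  shows "Bot \<notin> M"
    and "Conj A B \<in> M \<longleftrightarrow> A \<in> M \<and> B \<in> M"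
    and "Disj A B \<in> M \<longleftrightarrow> A \<in> M \<or> B \<in> M"
    and "Imp A B \<in> M \<longleftrightarrow> (A \<in> M \<longrightarrow> B \<in> M)"
proof -
  have M: "CND_theory M" and neg: "\<And>A. Neg A \<in> M \<longleftrightarrow> A \<notin> M"
    using assms unfolding complete_theory_def by blast+
  note c1 = theory_conseq1[OF M] and c2 = theory_conseq2[OF M]
  have "Neg Bot \<in> M" using theory_CND[OF M] CND_taut by (auto simp: tautology_def)
  then show "Bot \<notin> M" using neg by blast
  show "Conj A B \<in> M \<longleftrightarrow> A \<in> M \<and> B \<in> M"
    using c1[of "Conj A B" A] c1[of "Conj A B" B] c2[of A B "Conj A B"]
    by (auto simp: tautology_def)
  show "Disj A B \<in> M \<longleftrightarrow> A \<in> M \<or> B \<in> M"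
    using c1[of A "Disj A B"] c1[of B "Disj A B"] c2[of "Disj A B" "Neg A" B] neg
    by (auto simp: tautology_def)
  show "Imp A B \<in> M \<longleftrightarrow> (A \<in> M \<longrightarrow> B \<in> M)"
    using c1[of "Neg A" "Imp A B"] c1[of B "Imp A B"] c2[of A "Imp A B" B] neg
    by (auto simp: tautology_def)
qed

text \<open>The formulas boxed in \<open>M\<close> contain \<open>CND\<close> and are closed under conjunction by \<open>C\<close>, so their
  consequences already follow from single boxed formulas. If \<open>Bot\<close> were one of them,
  some boxed \<open>B\<close> would be refutable, and then \<open>Box B\<close> and \<open>Box (Neg B)\<close> would both lie in \<open>M\<close>,
  contradicting \<open>D\<close>.\<close>

lemma complete_theory_successor:
  assumes "complete_theory M"
  shows "\<exists>N. complete_theory N \<and> (\<forall>A. Box A \<in> M \<longrightarrow> A \<in> N)"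
proof -
  have M: "CND_theory M" using assms unfolding complete_theory_def by blast
  note M_truth = complete_theory_truth[OF assms]
  have box_conj: "Box (Conj A B) \<in> M" if "Box A \<in> M" "Box B \<in> M" for A B
    using theory_CND[OF M CND_C, of A B] that by (simp add: M_truth)
  have box_nec: "Box A \<in> M" if "A \<in> CND" for A
    using theory_CND[OF M CND_nec[OF that]] .
  let ?L = "{C. \<exists>B. Box B \<in> M \<and> Imp B C \<in> CND}"
  have refl: "Imp C C \<in> CND" for C by (rule CND_taut) (simp add: tautology_def)
  have "CND_theory ?L"
    unfolding CND_theory_def
  proof (intro conjI allI impI)
    show "CND \<subseteq> ?L" using box_nec refl by blast
  next
    fix C D assume "C \<in> ?L" "Imp C D \<in> ?L"
    then obtain B B' where B: "Box B \<in> M" "Imp B C \<in> CND"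
      and B': "Box B' \<in> M" "Imp B' (Imp C D) \<in> CND" by blast
    have "Imp (Conj B B') D \<in> CND"
      by (rule theory_conseq2[OF CND_theory_CND B(2) B'(2)]) (auto simp: tautology_def)
    then show "D \<in> ?L" using box_conj B B' by blast
  qed
  moreover have "Bot \<notin> ?L"
  proof
    assume "Bot \<in> ?L"
    then obtain B where B: "Box B \<in> M" "Imp B Bot \<in> CND" by blast
    have "Neg B \<in> CND"
      by (rule theory_conseq1[OF CND_theory_CND B(2)]) (auto simp: tautology_def)
    then have "Conj (Box B) (Box (Neg B)) \<in> M" using box_nec B by (simp add: M_truth)
    then show False
      using theory_CND[OF M CND_D] assms unfolding complete_theory_def by blast
  qed
  ultimately obtain N where "complete_theory N" "?L \<subseteq> N" using lindenbaum by blast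
  then show ?thesis using refl by blast
qed

lemma countermodel_complete:
  assumes S: "A \<in> S" and A: "A \<notin> CND"
  shows "\<exists>U\<subseteq>Pow S. countermodel S A U"
proof -
  let ?U = "{S \<inter> M |M. complete_theory M}"
  have prov: "B \<in> CND" if "B \<in> S" "\<forall>u\<in>?U. B \<in> u" for B
  proof (rule ccontr)
    assume "B \<notin> CND"
    then obtain M where "complete_theory M" "B \<notin> M" using lindenbaum[OF CND_theory_CND] by blast
    then show False using that(2) by auto
  qed
  have "coherent S ?U (S \<inter> M)" if M: "complete_theory M" for M
  proof -
    have th: "CND_theory M" and neg: "\<And>A. Neg A \<in> M \<longleftrightarrow> A \<notin> M"
      using M unfolding complete_theory_def by blast+
    note M_truth = complete_theory_truth[OF M]
    let ?X = "{B \<in> S. Box B \<in> M}"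
    have "\<forall>B\<in>S. (\<forall>u\<in>?U. B \<in> u) \<longrightarrow> B \<in> ?X"
      using prov CND_nec theory_CND[OF th] by blast
    moreover have "Conj B C \<in> ?X" if "Conj B C \<in> S" "B \<in> ?X" "C \<in> ?X" for B C
      using that theory_CND[OF th CND_C, of B C] by (simp add: M_truth)
    moreover have "\<exists>u\<in>?U. \<forall>B\<in>S. B \<in> ?X \<longrightarrow> B \<in> u"
    proof -
      obtain N where "complete_theory N" "\<forall>B. Box B \<in> M \<longrightarrow> B \<in> N"
        using complete_theory_successor[OF M] by blast
      then show ?thesis by (intro bexI[of _ "S \<inter> N"]) auto
    qed
    ultimately have "box_set S ?U (S \<inter> M) ?X"
      unfolding box_set_def by blast
    then have "\<exists>X\<in>Pow S. box_set S ?U (S \<inter> M) X" by blast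
    then show ?thesis
      unfolding coherent_def by (simp add: M_truth neg)
  qed
  moreover have "\<exists>t\<in>?U. A \<notin> t" using lindenbaum[OF CND_theory_CND A] by blast
  ultimately have "countermodel S A ?U" unfolding countermodel_def by blast
  then show ?thesis by (intro exI[of _ ?U]) auto
qed

section \<open>Coding of countermodels by numbers\<close>

lemma set_decode_subset:
  assumes "t < 2 ^ N"
  shows "set_decode t \<subseteq> {..<N}"
proof
  fix c assume c: "c \<in> set_decode t"
  have "c < N"
  proof (rule ccontr)
    assume "\<not> c < N"
    then have "(2::nat) ^ N \<le> 2 ^ c" by (intro power_increasing) auto
    then have "t div 2 ^ c = 0" using assms by (intro div_less) (rule less_le_trans)
    then show False using c by (simp add: set_decode_def)
  qed
  then show "c \<in> {..<N}" by simp
qed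

lemma set_encode_less:
  assumes "A \<subseteq> {..<N}"
  shows "set_encode A < 2 ^ N"
proof -
  have "set_encode A \<le> (\<Sum>i<N. 2 ^ i)"
    unfolding set_encode_def by (rule sum_mono2) (use assms in auto)
  also have "\<dots> = 2 ^ N - 1" by (simp add: sum_power2 lessThan_atLeast0)
  also have "\<dots> < 2 ^ N" by simp
  finally show ?thesis .
qed

lemma less_prod_encode2: "0 < a \<Longrightarrow> b < prod_encode (a, b)"
proof -
  assume "0 < a"
  moreover have "k \<le> triangle k" for k by (induction k) auto
  then have "a + b \<le> triangle (a + b)" .
  ultimately show ?thesis unfolding prod_encode_def by simp
qed

lemma fm_code_less:
  "fm_code A < fm_code (Neg A)" "fm_code A < fm_code (Box A)"
  "fm_code A < fm_code (Conj A B)" "fm_code B < fm_code (Conj A B)"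
  "fm_code A < fm_code (Disj A B)" "fm_code B < fm_code (Disj A B)"
  "fm_code A < fm_code (Imp A B)" "fm_code B < fm_code (Imp A B)"
  using le_prod_encode_1[of "fm_code A" "fm_code B"] le_prod_encode_2[of "fm_code B" "fm_code A"]
  by (auto intro!: less_prod_encode2 le_less_trans[OF _ less_prod_encode2])

definition fms_upto :: "nat \<Rightarrow> fm set" where
  "fms_upto n = {A. fm_code A \<le> n}"

lemma subfm_closed_fms_upto: "subfm_closed (fms_upto n)"
  unfolding subfm_closed_def fms_upto_def mem_Collect_eq
  by (meson fm_code_less less_imp_le order_trans)

text \<open>One unfolding of the statement that \<open>c\<close> codes a formula, where \<open>P\<close> tells which smaller numbers do.\<close>

definition code_step :: "(nat \<Rightarrow> bool) \<Rightarrow> nat \<Rightarrow> bool" where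
  "code_step P c \<longleftrightarrow>
     (\<exists>k<Suc c. c = prod_encode (0, k)) \<or> c = prod_encode (1, 0) \<or>
     (\<exists>a<c. P a \<and>
        (c = prod_encode (2, a) \<or> c = prod_encode (6, a) \<or>
         (\<exists>b<c. P b \<and>
            (c = prod_encode (3, prod_encode (a, b)) \<or> c = prod_encode (4, prod_encode (a, b)) \<or>
             c = prod_encode (5, prod_encode (a, b))))))"

lemma code_step_cong: "(\<And>a. a < c \<Longrightarrow> P a \<longleftrightarrow> Q a) \<Longrightarrow> code_step P c \<longleftrightarrow> code_step Q c"
  unfolding code_step_def by (simp cong: conj_cong)

text \<open>\<open>F\<close> codes the set of formula codes up to \<open>n\<close>. As \<open>code_step\<close> depends only on the values of \<open>P\<close> below \<open>c\<close>,
  the condition determines the bits of \<open>F\<close> up to \<open>n\<close>.\<close>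

definition codes_table :: "nat \<Rightarrow> nat \<Rightarrow> bool" where
  "codes_table n F \<longleftrightarrow>
     (\<forall>c<Suc n. c \<in> set_decode F \<longleftrightarrow> code_step (\<lambda>a. a \<in> set_decode F) c)"

lemma range_fm_code_iff:
  "c \<in> range fm_code \<longleftrightarrow> code_step (\<lambda>a. a \<in> range fm_code) c" (is "?L \<longleftrightarrow> ?R")
proof
  assume ?L
  then obtain C where C: "c = fm_code C" by blast
  show ?R
  proof (cases C)
    case (Var k)
    then show ?thesis unfolding code_step_def using C le_prod_encode_2[of k 0] by (auto simp: less_Suc_eq_le)
  next
    case Bot
    then show ?thesis unfolding code_step_def using C by simp
  next
    case (Neg A)
    then show ?thesis unfolding code_step_def using C fm_code_less(1)[of A] by auto
  next
    case (Conj A B)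
    then show ?thesis unfolding code_step_def using C fm_code_less(3,4)[where A=A and B=B] by fastforce
  next
    case (Disj A B)
    then show ?thesis unfolding code_step_def using C fm_code_less(5,6)[where A=A and B=B] by fastforce
  next
    case (Imp A B)
    then show ?thesis unfolding code_step_def using C fm_code_less(7,8)[where A=A and B=B] by fastforce
  next
    case (Box A)
    then show ?thesis unfolding code_step_def using C fm_code_less(2)[of A] by auto
  qed
next
  note ranges = rangeI[of fm_code "Var k" for k] rangeI[of fm_code Bot] rangeI[of fm_code "Neg A" for A]
    rangeI[of fm_code "Conj A B" for A B] rangeI[of fm_code "Disj A B" for A B]
    rangeI[of fm_code "Imp A B" for A B] rangeI[of fm_code "Box A" for A]
  assume ?R
  then show ?L
    unfolding code_step_def
    by (elim disjE exE conjE imageE) (simp_all only: ranges[unfolded fm_code.simps])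
qed

lemma codes_table_iff:
  assumes "F < 2 ^ Suc n"
  shows "codes_table n F \<longleftrightarrow> set_decode F = fm_code ` fms_upto n"
proof
  assume F: "codes_table n F"
  have "c \<le> n \<Longrightarrow> c \<in> set_decode F \<longleftrightarrow> c \<in> range fm_code" for c
  proof (induction c rule: less_induct)
    case (less c)
    have "c \<in> set_decode F \<longleftrightarrow> code_step (\<lambda>a. a \<in> set_decode F) c"
      using F less.prems unfolding codes_table_def by simp
    also have "\<dots> \<longleftrightarrow> code_step (\<lambda>a. a \<in> range fm_code) c"
      using less by (intro code_step_cong) simp
    finally show ?case unfolding range_fm_code_iff[symmetric] .
  qed
  moreover have "c \<le> n" if "c \<in> set_decode F" for c
    using set_decode_subset[OF assms] that by auto
  ultimately show "set_decode F = fm_code ` fms_upto n"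
    unfolding fms_upto_def by blast
next
  assume "set_decode F = fm_code ` fms_upto n"
  then have F: "c \<in> set_decode F \<longleftrightarrow> c \<in> range fm_code" if "c \<le> n" for c
    using that unfolding fms_upto_def by auto
  have "c \<in> set_decode F \<longleftrightarrow> code_step (\<lambda>a. a \<in> set_decode F) c" if "c < Suc n" for c
  proof -
    have "code_step (\<lambda>a. a \<in> set_decode F) c \<longleftrightarrow> code_step (\<lambda>a. a \<in> range fm_code) c"
      using that by (intro code_step_cong F) simp
    then show ?thesis using that F[of c] range_fm_code_iff[of c] by simp
  qed
  then show "codes_table n F" unfolding codes_table_def by blast
qed

text \<open>The set of formulas whose codes belong to the finite set coded by \<open>t\<close>. Bits of \<open>t\<close> at positions that are
  not formula codes are ignored, so different numbers may represent the same set.\<close>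

definition decode_fms :: "nat \<Rightarrow> fm set" where
  "decode_fms t = fm_code -` set_decode t"

text \<open>The set of types coded by \<open>U\<close>. Only elements below \<open>2 ^ Suc n\<close> count: they represent sets of formulas
  with codes up to \<open>n\<close>.\<close>

definition decode_types :: "nat \<Rightarrow> nat \<Rightarrow> fm set set" where
  "decode_types n U = decode_fms ` {t. t < 2 ^ Suc n \<and> t \<in> set_decode U}"

lemma ex_decode_fms:
  assumes "T \<subseteq> fms_upto n"
  shows "\<exists>t<2 ^ Suc n. decode_fms t = T"
proof -
  have sub: "fm_code ` T \<subseteq> {..<Suc n}" using assms unfolding fms_upto_def by auto
  have "set_decode (set_encode (fm_code ` T)) = fm_code ` T"
    by (intro set_encode_inverse finite_subset[OF sub]) simp
  then have "decode_fms (set_encode (fm_code ` T)) = T"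
    unfolding decode_fms_def by (simp add: inj_vimage_image_eq inj_fm_code)
  then show ?thesis using set_encode_less[OF sub] by blast
qed

lemma decode_fms_subset: "t < 2 ^ Suc n \<Longrightarrow> decode_fms t \<subseteq> fms_upto n"
  using set_decode_subset[of t "Suc n"] unfolding decode_fms_def fms_upto_def
  by (auto simp: less_Suc_eq_le)

lemma ex_decode_types:
  assumes "U \<subseteq> Pow (fms_upto n)"
  shows "\<exists>u<2 ^ 2 ^ Suc n. decode_types n u = U"
proof -
  let ?T = "{t. t < 2 ^ Suc n \<and> decode_fms t \<in> U}"
  have sub: "?T \<subseteq> {..<2 ^ Suc n}" by auto
  have "set_decode (set_encode ?T) = ?T"
    by (intro set_encode_inverse finite_subset[OF sub]) simp
  then have "decode_types n (set_encode ?T) = decode_fms ` ?T"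
    unfolding decode_types_def by blast
  also have "\<dots> = U"
  proof
    show "U \<subseteq> decode_fms ` ?T"
    proof
      fix u assume u: "u \<in> U"
      then obtain t where "t < 2 ^ Suc n" "decode_fms t = u"
        using ex_decode_fms[of u n] assms by blast
      then show "u \<in> decode_fms ` ?T" using u by blast
    qed
  qed blast
  finally have "decode_types n (set_encode ?T) = U" .
  then show ?thesis using set_encode_less[OF sub] by blast
qed

text \<open>The next three predicates are the arithmetical counterparts of \<open>box_set\<close>, \<open>coherent\<close> and
  \<open>countermodel\<close> for the formulas with codes up to \<open>n\<close>. The number \<open>F\<close> stands for the set of these codes and
  serves to restrict the quantifiers.\<close>

definition num_box_set :: "nat \<Rightarrow> nat \<Rightarrow> nat \<Rightarrow> nat \<Rightarrow> nat \<Rightarrow> bool" where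
  "num_box_set n F U t X \<longleftrightarrow>
     (\<forall>a<Suc n. a \<in> set_decode F \<longrightarrow>
        (\<forall>u<2 ^ Suc n. u \<in> set_decode U \<longrightarrow> a \<in> set_decode u) \<longrightarrow> a \<in> set_decode X) \<and>
     (\<forall>a<Suc n. a \<in> set_decode F \<longrightarrow> (\<forall>b<Suc n. b \<in> set_decode F \<longrightarrow>
        prod_encode (3, prod_encode (a, b)) \<in> set_decode F \<longrightarrow>
        a \<in> set_decode X \<longrightarrow> b \<in> set_decode X \<longrightarrow>
        prod_encode (3, prod_encode (a, b)) \<in> set_decode X)) \<and>
     (\<forall>a<Suc n. a \<in> set_decode F \<longrightarrow> prod_encode (6, a) \<in> set_decode F \<longrightarrow>
        (prod_encode (6, a) \<in> set_decode t \<longleftrightarrow> a \<in> set_decode X)) \<and>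
     (\<exists>u<2 ^ Suc n. u \<in> set_decode U \<and>
        (\<forall>a<Suc n. a \<in> set_decode F \<longrightarrow> a \<in> set_decode X \<longrightarrow> a \<in> set_decode u))"

definition num_coherent :: "nat \<Rightarrow> nat \<Rightarrow> nat \<Rightarrow> nat \<Rightarrow> bool" where
  "num_coherent n F U t \<longleftrightarrow>
     \<not> prod_encode (1, 0) \<in> set_decode t \<and>
     (\<forall>a<Suc n. a \<in> set_decode F \<longrightarrow> prod_encode (2, a) \<in> set_decode F \<longrightarrow>
        (prod_encode (2, a) \<in> set_decode t \<longleftrightarrow> \<not> a \<in> set_decode t)) \<and>
     (\<forall>a<Suc n. a \<in> set_decode F \<longrightarrow> (\<forall>b<Suc n. b \<in> set_decode F \<longrightarrow>
        (prod_encode (3, prod_encode (a, b)) \<in> set_decode F \<longrightarrow>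
          (prod_encode (3, prod_encode (a, b)) \<in> set_decode t \<longleftrightarrow>
             a \<in> set_decode t \<and> b \<in> set_decode t)) \<and>
        (prod_encode (4, prod_encode (a, b)) \<in> set_decode F \<longrightarrow>
          (prod_encode (4, prod_encode (a, b)) \<in> set_decode t \<longleftrightarrow>
             a \<in> set_decode t \<or> b \<in> set_decode t)) \<and>
        (prod_encode (5, prod_encode (a, b)) \<in> set_decode F \<longrightarrow>
          (prod_encode (5, prod_encode (a, b)) \<in> set_decode t \<longleftrightarrow>
             (a \<in> set_decode t \<longrightarrow> b \<in> set_decode t))))) \<and>
     (\<exists>X<2 ^ Suc n. num_box_set n F U t X)"

definition num_countermodel :: "nat \<Rightarrow> nat \<Rightarrow> nat \<Rightarrow> bool" where
  "num_countermodel n F U \<longleftrightarrow>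
     (\<forall>t<2 ^ Suc n. t \<in> set_decode U \<longrightarrow> num_coherent n F U t) \<and>
     (\<exists>t<2 ^ Suc n. t \<in> set_decode U \<and> \<not> n \<in> set_decode t)"

lemma mem_decode_fms: "A \<in> decode_fms t \<longleftrightarrow> fm_code A \<in> set_decode t"
  unfolding decode_fms_def by simp

lemma ball_decode_types:
  "(\<forall>u\<in>decode_types n U. P u) \<longleftrightarrow> (\<forall>u<2 ^ Suc n. u \<in> set_decode U \<longrightarrow> P (decode_fms u))"
  unfolding decode_types_def by blast

lemma bex_decode_types:
  "(\<exists>u\<in>decode_types n U. P u) \<longleftrightarrow> (\<exists>u<2 ^ Suc n. u \<in> set_decode U \<and> P (decode_fms u))"
  unfolding decode_types_def by blast

context
  fixes n F :: nat
  assumes F: "set_decode F = fm_code ` fms_upto n"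
begin

lemma ball_codes: "(\<forall>a<Suc n. a \<in> set_decode F \<longrightarrow> Q a) \<longleftrightarrow> (\<forall>A\<in>fms_upto n. Q (fm_code A))"
  unfolding F by (auto simp: fms_upto_def less_Suc_eq_le)

lemma code_in_table:
  "fm_code A \<in> set_decode F \<longleftrightarrow> A \<in> fms_upto n"
  unfolding F using inj_fm_code by (simp add: inj_image_mem_iff)

lemmas table_simps = ball_codes code_in_table code_in_table[of "Neg A" for A, simplified]
  code_in_table[of "Box A" for A, simplified] code_in_table[of "Conj A B" for A B, simplified]
  code_in_table[of "Disj A B" for A B, simplified] code_in_table[of "Imp A B" for A B, simplified]

lemma num_box_set_iff:
  "num_box_set n F U t X \<longleftrightarrow>
     box_set (fms_upto n) (decode_types n U) (decode_fms t) (decode_fms X)"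
  unfolding num_box_set_def box_set_def table_simps ball_decode_types bex_decode_types mem_decode_fms
    fm_code.simps ..

lemma num_coherent_iff:
  "num_coherent n F U t \<longleftrightarrow> coherent (fms_upto n) (decode_types n U) (decode_fms t)"
proof -
  have "(\<exists>X<2 ^ Suc n. num_box_set n F U t X) \<longleftrightarrow>
      (\<exists>X\<in>Pow (fms_upto n). box_set (fms_upto n) (decode_types n U) (decode_fms t) X)"
    (is "?L \<longleftrightarrow> ?R")
  proof
    assume ?L
    then show ?R unfolding num_box_set_iff using decode_fms_subset by blast
  next
    assume ?R
    then obtain Y where Y: "Y \<subseteq> fms_upto n"
      "box_set (fms_upto n) (decode_types n U) (decode_fms t) Y" by blast
    then obtain X where "X < 2 ^ Suc n" "decode_fms X = Y" using ex_decode_fms by blast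
    then show ?L unfolding num_box_set_iff using Y by blast
  qed
  then show ?thesis
    unfolding num_coherent_def coherent_def table_simps mem_decode_fms fm_code.simps by (rule arg_cong)
qed

lemma num_countermodel_iff:
  assumes "n = fm_code A"
  shows "num_countermodel n F U \<longleftrightarrow> countermodel (fms_upto n) A (decode_types n U)"
  unfolding num_countermodel_def countermodel_def ball_decode_types bex_decode_types
    num_coherent_iff mem_decode_fms assms[symmetric] ..

end

lemma code_in_CND_iff:
  "n \<in> fm_code ` CND \<longleftrightarrow>
     (\<exists>F<2 ^ Suc n. codes_table n F \<and> n \<in> set_decode F \<and>
        \<not> (\<exists>U<2 ^ 2 ^ Suc n. num_countermodel n F U))"
proof -
  have main: "(\<exists>U<2 ^ 2 ^ Suc n. num_countermodel n F U) \<longleftrightarrow> A \<notin> CND"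
    if F: "set_decode F = fm_code ` fms_upto n" and A: "n = fm_code A" for F A
  proof -
    have "(\<exists>U<2 ^ 2 ^ Suc n. num_countermodel n F U) \<longleftrightarrow>
        (\<exists>U<2 ^ 2 ^ Suc n. countermodel (fms_upto n) A (decode_types n U))"
      using num_countermodel_iff[OF F A] A by simp
    also have "\<dots> \<longleftrightarrow> A \<notin> CND"
    proof
      assume "\<exists>U<2 ^ 2 ^ Suc n. countermodel (fms_upto n) A (decode_types n U)"
      then show "A \<notin> CND"
        using countermodel_sound[OF subfm_closed_fms_upto] A unfolding fms_upto_def by blast
    next
      assume "A \<notin> CND"
      then obtain U where "U \<subseteq> Pow (fms_upto n)" "countermodel (fms_upto n) A U"
        using countermodel_complete[of A "fms_upto n"] A unfolding fms_upto_def by blast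
      then show "\<exists>U<2 ^ 2 ^ Suc n. countermodel (fms_upto n) A (decode_types n U)"
        using ex_decode_types by metis
    qed
    finally show ?thesis .
  qed
  have sub: "fm_code ` fms_upto n \<subseteq> {..<Suc n}" unfolding fms_upto_def by auto
  have dec: "set_decode (set_encode (fm_code ` fms_upto n)) = fm_code ` fms_upto n"
    by (intro set_encode_inverse finite_subset[OF sub]) simp
  show ?thesis
  proof
    assume "n \<in> fm_code ` CND"
    then obtain A where A: "n = fm_code A" "A \<in> CND" by blast
    let ?F = "set_encode (fm_code ` fms_upto n)"
    have lt: "?F < 2 ^ Suc n" using set_encode_less[OF sub] .
    have "n \<in> set_decode ?F" using A unfolding dec by (auto simp: fms_upto_def)
    moreover have "codes_table n ?F" using codes_table_iff[OF lt] dec by blast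
    ultimately show "\<exists>F<2 ^ Suc n. codes_table n F \<and> n \<in> set_decode F \<and>
        \<not> (\<exists>U<2 ^ 2 ^ Suc n. num_countermodel n F U)"
      using lt main[OF dec A(1)] A(2) by blast
  next
    assume "\<exists>F<2 ^ Suc n. codes_table n F \<and> n \<in> set_decode F \<and>
        \<not> (\<exists>U<2 ^ 2 ^ Suc n. num_countermodel n F U)"
    then obtain F where F: "F < 2 ^ Suc n" "codes_table n F" "n \<in> set_decode F"
      and no: "\<not> (\<exists>U<2 ^ 2 ^ Suc n. num_countermodel n F U)" by blast
    have tab: "set_decode F = fm_code ` fms_upto n" using codes_table_iff[OF F(1)] F(2) by blast
    then obtain A where A: "n = fm_code A" using F(3) by blast
    then show "n \<in> fm_code ` CND" using main[OF tab A] no by blast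
  qed
qed

theorem lemma3p25: "prim_rec_set (fm_code ` CND)"
proof -
  have "pr_pred (Suc 0) (\<lambda>xs. hd xs \<in> fm_code ` CND)"
    unfolding code_in_CND_iff codes_table_def code_step_def num_countermodel_def num_coherent_def num_box_set_def
    by (rule pr_intros)+
  then obtain f where f: "prim_rec 1 f"
    and f_eq: "\<And>xs. length xs = Suc 0 \<Longrightarrow> of_bool (hd xs \<in> fm_code ` CND) = f xs"
    unfolding pr_pred_def pr_fun_def by auto
  have "f [n] = (if n \<in> fm_code ` CND then 1 else 0)" for n
    using f_eq[of "[n]"] by (simp add: of_bool_def)
  then show ?thesis unfolding prim_rec_set_def using f by blast
qed

end
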